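(* Let $n \ge 3$ be an integer and let $A \subseteq \{1, 2, \ldots, 2n\}$ be a set with $|A| \ge n+1$. Then there exist integers $0 \le b_1 < b_2 < b_3$ such that $b_1+b_2$, $b_1+b_3$ and $b_2+b_3$ all belong to $A$. *)

theory Defs
  imports Main
begin

end

(* Solving for the b's, one needs x < y < z in A with x + y + z even and z <= x + y.
   Induct on n. If 2n - 1 or 2n is missing from A, then A without {2n - 1, 2n} is an instance
   for n - 1. Otherwise any odd x < 2n - 1 in A completes (x, 2n - 1, 2n); if there is none,
   A consists of 2n - 1 and all the even numbers up to 2n, and (2, 4, 6) works. *)
theory Submission imports Defs begin

definition even_triangle_in :: "int set \<Rightarrow> bool" where
  "even_triangle_in A \<longleftrightarrow>
     (\<exists>x\<in>A. \<exists>y\<in>A. \<exists>z\<in>A. x < y \<and> y < z \<and> z \<le> x + y \<and> even (x + y + z))"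

lemma even_triangle_inI:
  assumes "x \<in> A" "y \<in> A" "z \<in> A" "x < y" "y < z" "z \<le> x + y" "even (x + y + z)"
  shows "even_triangle_in A"
  unfolding even_triangle_in_def using assms by blast

lemma even_triangle_in_mono:
  assumes "even_triangle_in A" "A \<subseteq> B"
  shows "even_triangle_in B"
  using assms unfolding even_triangle_in_def by blast

text \<open>With \<open>s\<close> half the perimeter, an integer by parity, the solution is
  \<open>s - z\<close>, \<open>s - y\<close>, \<open>s - x\<close>: each sum of two of them is a
  side, and \<open>z \<le> x + y\<close> says exactly that \<open>s - z\<close> is
  nonnegative.\<close>

lemma pair_sums_if_even_triangle_in:
  assumes "even_triangle_in A"
  shows "\<exists>b1 b2 b3 :: int. 0 \<le> b1 \<and> b1 < b2 \<and> b2 < b3 \<and>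
           b1 + b2 \<in> A \<and> b1 + b3 \<in> A \<and> b2 + b3 \<in> A"
proof -
  obtain x y z where xyz: "x \<in> A" "y \<in> A" "z \<in> A" "x < y" "y < z" "z \<le> x + y"
    and "even (x + y + z)"
    using assms unfolding even_triangle_in_def by blast
  then obtain s where s: "x + y + z = 2 * s" by (elim evenE)
  have sums: "(s - z) + (s - y) = x" "(s - z) + (s - x) = y" "(s - y) + (s - x) = z"
    using s by linarith+
  have "0 \<le> s - z" "s - z < s - y" "s - y < s - x" using xyz s by linarith+
  then have "0 \<le> s - z \<and> s - z < s - y \<and> s - y < s - x \<and>
      (s - z) + (s - y) \<in> A \<and> (s - z) + (s - x) \<in> A \<and> (s - y) + (s - x) \<in> A"
    unfolding sums using xyz by blast
  then show ?thesis by (intro exI)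
qed

lemma even_triangle_in_if_top_pair:
  fixes n :: nat
  assumes "n \<ge> 3" "A \<subseteq> {1..2 * int n}" "card A \<ge> n + 1"
    and top: "2 * int n - 1 \<in> A" "2 * int n \<in> A"
  shows "even_triangle_in A"
proof (cases "\<exists>x\<in>A. odd x \<and> x \<noteq> 2 * int n - 1")
  case True
  then obtain x where x: "x \<in> A" "odd x" "x \<noteq> 2 * int n - 1" by blast
  then have "1 \<le> x" "x \<le> 2 * int n" "x \<noteq> 2 * int n" using assms(2) by auto
  \<comment> \<open>Here \<open>x < 2 * int n - 1\<close>; as the two largest sides differ by 1,
    \<open>x \<ge> 1\<close> is all the triangle inequality needs, and two odd sides and an even one
    have an even sum.\<close>
  then show ?thesis
    using x top by (intro even_triangle_inI[of x _ "2 * int n - 1" "2 * int n"]) auto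
next
  case False
  \<comment> \<open>\<open>E\<close> collects all that \<open>A\<close> can still contain. It has at
    most \<open>n + 1\<close> elements, so the lower bound on \<open>card A\<close> forces
    \<open>A = E\<close>.\<close>
  define E where "E = insert (2 * int n - 1) ((\<lambda>k. 2 * int k) ` {1..n})"
  have "A \<subseteq> E"
  proof
    fix x assume x: "x \<in> A"
    show "x \<in> E"
    proof (cases "even x")
      case True
      then obtain k where k: "x = 2 * k" by (elim evenE)
      moreover have "1 \<le> x" "x \<le> 2 * int n" using x assms(2) by auto
      ultimately have "nat k \<in> {1..n}" "x = 2 * int (nat k)" by auto
      then show ?thesis unfolding E_def by blast
    next
      case False
      then show ?thesis using x \<open>\<not> (\<exists>x\<in>A. _ x)\<close> unfolding E_def by blast
    qed
  qed
  moreover have "finite E" unfolding E_def by simp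
  moreover have "card E \<le> card A"
  proof -
    have "card E \<le> Suc (card ((\<lambda>k. 2 * int k) ` {1..n}))"
      unfolding E_def by (rule card_insert_le_m1) auto
    also have "\<dots> \<le> Suc n" using card_image_le[of "{1..n}" "\<lambda>k. 2 * int k"] by simp
    finally show ?thesis using assms(3) by simp
  qed
  ultimately have "A = E" by (simp add: card_seteq)
  \<comment> \<open>The numbers 2, 4, 6 are written in the shape of the image in \<open>E\<close>;
    the last one needs \<open>n \<ge> 3\<close>.\<close>
  moreover have "2 * int 1 \<in> E" "2 * int 2 \<in> E" "2 * int 3 \<in> E"
    using \<open>n \<ge> 3\<close> unfolding E_def by (auto intro!: imageI simp del: of_nat_numeral)
  ultimately show ?thesis by (intro even_triangle_inI[of 2 _ 4 6]) auto
qed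

text \<open>A finite check: every 4-element subset of \<open>{1..6}\<close> contains one of eight
  admissible triples. The induction cannot start at \<open>n = 2\<close>, where
  \<open>{1, 2, 4}\<close> is a counterexample.\<close>

lemma even_triangle_in_base:
  assumes "A \<subseteq> {1..6}" "card A \<ge> 4"
  shows "even_triangle_in A"
proof (rule ccontr)
  assume no: "\<not> even_triangle_in A"
  have "{1..6::int} = {1, 2, 3, 4, 5, 6}" by auto
  then have A: "A = {1, 2, 3, 4, 5, 6} \<inter> A" using assms(1) by blast
  \<comment> \<open>As a sum of six membership indicators, the cardinality can be bounded by case
    distinction on which numbers lie in \<open>A\<close>.\<close>
  have "card A = (\<Sum>x\<in>{1, 2, 3, 4, 5, 6}. if x \<in> A then 1 else 0)"
    by (subst A, subst card_eq_sum, subst sum.inter_restrict) auto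
  moreover have "\<not> (1 \<in> A \<and> 2 \<in> A \<and> 3 \<in> A)" "\<not> (1 \<in> A \<and> 3 \<in> A \<and> 4 \<in> A)"
    "\<not> (1 \<in> A \<and> 4 \<in> A \<and> 5 \<in> A)" "\<not> (1 \<in> A \<and> 5 \<in> A \<and> 6 \<in> A)"
    "\<not> (2 \<in> A \<and> 4 \<in> A \<and> 6 \<in> A)" "\<not> (3 \<in> A \<and> 4 \<in> A \<and> 5 \<in> A)"
    "\<not> (3 \<in> A \<and> 5 \<in> A \<and> 6 \<in> A)" "\<not> (2 \<in> A \<and> 3 \<in> A \<and> 5 \<in> A)"
    using no even_triangle_inI[of 1 A 2 3] even_triangle_inI[of 1 A 3 4]
      even_triangle_inI[of 1 A 4 5] even_triangle_inI[of 1 A 5 6]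
      even_triangle_inI[of 2 A 4 6] even_triangle_inI[of 3 A 4 5]
      even_triangle_inI[of 3 A 5 6] even_triangle_inI[of 2 A 3 5] by auto
  ultimately show False using assms(2) by (auto split: if_splits)
qed

lemma even_triangle_in_if_card_gt:
  fixes n :: nat
  assumes "n \<ge> 3" "A \<subseteq> {1..2 * int n}" "card A \<ge> n + 1"
  shows "even_triangle_in A"
  using assms
proof (induction n arbitrary: A rule: dec_induct)
  case base
  then show ?case by (intro even_triangle_in_base) auto
next
  case (step n)
  let ?N = "2 * int (Suc n)"
  show ?case
  proof (cases "?N - 1 \<in> A \<and> ?N \<in> A")
    case True
    then show ?thesis
      using step by (intro even_triangle_in_if_top_pair[of "Suc n"]) auto
  next
    case False
    define B where "B = A \<inter> {1..2 * int n}"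
    \<comment> \<open>At most one of \<open>?N - 1\<close> and \<open>?N\<close> lies in
      \<open>A\<close>. If neither does, inserting \<open>?N - 1\<close> is harmless, since only an
      upper bound on \<open>card A\<close> is wanted.\<close>
    have "A \<subseteq> insert (if ?N \<in> A then ?N else ?N - 1) B"
    proof
      fix x assume x: "x \<in> A"
      then have "1 \<le> x" "x \<le> ?N" using step.prems(1) by auto
      then have "x = ?N \<or> x = ?N - 1 \<or> x \<le> 2 * int n" by arith
      then have "x = ?N \<or> x = ?N - 1 \<or> x \<in> B"
        using x \<open>1 \<le> x\<close> unfolding B_def by simp
      then show "x \<in> insert (if ?N \<in> A then ?N else ?N - 1) B"
        using False x by (elim disjE) simp_all
    qed
    moreover have "finite B" unfolding B_def by simp
    ultimately have "card A \<le> card (insert (if ?N \<in> A then ?N else ?N - 1) B)"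
      by (intro card_mono) auto
    also have "\<dots> \<le> Suc (card B)" by (rule card_insert_le_m1) auto
    finally have "card A \<le> Suc (card B)" .
    \<comment> \<open>From \<open>card A \<ge> n + 2\<close> and the loss of at most one element,
      \<open>card B \<ge> n + 1\<close>, as the induction hypothesis requires.\<close>
    then have "even_triangle_in B"
      using step.prems(2) by (intro step.IH) (auto simp: B_def)
    then show ?thesis by (rule even_triangle_in_mono) (auto simp: B_def)
  qed
qed

theorem theorem3:
  fixes n :: nat and A :: "int set"
  assumes "n \<ge> 3"
    and "A \<subseteq> {1..2 * int n}"
    and "card A \<ge> n + 1"
  shows "\<exists>b1 b2 b3 :: int. 0 \<le> b1 \<and> b1 < b2 \<and> b2 < b3 \<and>
           b1 + b2 \<in> A \<and> b1 + b3 \<in> A \<and> b2 + b3 \<in> A"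
  using even_triangle_in_if_card_gt[OF assms] by (rule pair_sums_if_even_triangle_in)

end
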